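(* Let $F$ be a field, let $n,k\in\mathbb{Z}^+$, and let $$f(x_1,\ldots,x_n)=a_1x_1^k+\cdots+a_nx_n^k+g(x_1,\ldots,x_n)\in F[x_1,\ldots,x_n],$$ where $a_1,\ldots,a_n\in F\setminus\{0\}$ and $g\in F[x_1,\ldots,x_n]$ has $\deg g<k$. Suppose that $n\leq k=\deg f$. Let $A_1,\ldots,A_n$ be finite subsets of $F$ with $|A_i|\geq i$ for $i=1,\ldots,n$. Then, for the restricted value set $$V=\{f(x_1,\ldots,x_n):\ x_1\in A_1,\ldots,x_n\in A_n,\ \text{and}\ x_i\neq x_j\ \text{if}\ i\neq j\},$$ we have $$|V|\geq\min\left\{p(F),\ \sum_{i=1}^n\left\lfloor\frac{|A_i|-i}{k}\right\rfloor+1\right\}.$$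
   Context: $\mathbb{Z}^+=\{1,2,3,\ldots\}$. For a field $F$, $p(F)$ denotes the additive order of the multiplicative identity of $F$: $p(F)=p$ if $F$ has prime characteristic $p$, and $p(F)=+\infty$ if $F$ has characteristic zero. $\deg$ denotes total degree; the zero polynomial is allowed as $g$ (its degree is regarded as less than $k$). $\lfloor\alpha\rfloor$ denotes the largest integer not exceeding the real number $\alpha$. *)

theory Defs
  imports "HOL-Library.Poly_Mapping" "HOL-Library.Extended_Real"
begin

text \<open>
  Polynomials over \<open>'a\<close> in variables indexed by the natural numbers: finitely supported maps from
  exponent vectors to coefficients. The product of \<open>HOL-Library.Poly_Mapping\<close> is convolution
  along the addition of exponent vectors, i.e. polynomial multiplication.
\<close>

type_synonym 'a mpoly = "(nat \<Rightarrow>\<^sub>0 nat) \<Rightarrow>\<^sub>0 'a"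

definition mconst :: "'a::zero \<Rightarrow> 'a mpoly"
  where "mconst c = Poly_Mapping.single 0 c"

definition mvar :: "nat \<Rightarrow> 'a::zero_neq_one mpoly"
  where "mvar i = Poly_Mapping.single (Poly_Mapping.single i 1) 1"

definition mvars :: "'a::zero mpoly \<Rightarrow> nat set"
  where "mvars p = (\<Union>m\<in>Poly_Mapping.keys p. Poly_Mapping.keys m)"

definition exp_degree :: "(nat \<Rightarrow>\<^sub>0 nat) \<Rightarrow> nat"
  where "exp_degree m = (\<Sum>i\<in>Poly_Mapping.keys m. Poly_Mapping.lookup m i)"

text \<open>The zero polynomial gets total degree \<open>0\<close>, so it satisfies \<open>total_degree p < k\<close> for every
  positive \<open>k\<close>.\<close>

definition total_degree :: "'a::zero mpoly \<Rightarrow> nat"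
  where "total_degree p = Max (insert 0 (exp_degree ` Poly_Mapping.keys p))"

definition meval :: "'a::comm_semiring_1 mpoly \<Rightarrow> (nat \<Rightarrow> 'a) \<Rightarrow> 'a"
  where "meval p x =
    (\<Sum>m\<in>Poly_Mapping.keys p.
      Poly_Mapping.lookup p m * (\<Prod>i\<in>Poly_Mapping.keys m. x i ^ Poly_Mapping.lookup m i))"

text \<open>The additive order of \<open>1\<close>. The library's \<open>CHAR('a)\<close> is \<open>0\<close> when this order is infinite.\<close>

definition add_order_one :: "'a::field itself \<Rightarrow> ereal"
  where "add_order_one _ = (if CHAR('a) = 0 then \<infinity> else ereal (real CHAR('a)))"

text \<open>The values of \<open>p\<close> at points with pairwise distinct coordinates \<open>x i \<in> A i\<close>, \<open>1 \<le> i \<le> n\<close>.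
  Points are functions on all of \<open>nat\<close>; coordinates outside \<open>{1..n}\<close> are irrelevant when
  \<open>mvars p \<subseteq> {1..n}\<close>.\<close>

definition restricted_values :: "'a::field mpoly \<Rightarrow> nat \<Rightarrow> (nat \<Rightarrow> 'a set) \<Rightarrow> 'a set"
  where "restricted_values p n A =
    {meval p x | x. (\<forall>i\<in>{1..n}. x i \<in> A i) \<and> (\<forall>i\<in>{1..n}. \<forall>j\<in>{1..n}. i \<noteq> j \<longrightarrow> x i \<noteq> x j)}"

end

theory Submission
  imports
    Defs
    "HOL-Computational_Algebra.Polynomial"
    "HOL-Computational_Algebra.Primes"
    "HOL-Combinatorics.Multiset_Permutations"
    "HOL-Combinatorics.Permutations"
begin

text \<open>
  Shrink each \<open>A i\<close> to a set \<open>B i\<close> with \<open>k * q i + i\<close> elements, where the sum \<open>N\<close> of the \<open>q i\<close> is the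
  claimed bound minus one, and suppose that there are at most \<open>N\<close> values. Padding the values to a
  list of \<open>N\<close> elements \<open>c\<close>, the product of all \<open>f - c\<close> and of the Vandermonde determinant vanishes
  on the grid of the \<open>B i\<close>, and its degree is at most the sum of the \<open>card (B i) - 1\<close>. By the
  Combinatorial Nullstellensatz the coefficient of the monomial with exponents
  \<open>card (B i) - 1 = k * q i + (i - 1)\<close> is then \<open>0\<close>. Only the leading form of \<open>f\<close> contributes to
  it, and because of \<open>n \<le> k\<close> only the diagonal term of the determinant does. So the coefficient is
  a multinomial coefficient of \<open>N\<close> times a product of powers of the \<open>a i\<close>, which is nonzero since
  \<open>N\<close> is below the characteristic.
\<close>

section \<open>Coefficient extraction on a grid\<close>

text \<open>The weighted sum of a polynomial of degree at most the sum of the \<open>card (A i) - 1\<close> over the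
  grid is its coefficient at that exponent vector, by Lagrange interpolation in each variable. This
  is the Combinatorial Nullstellensatz as a statement about functions.\<close>

definition nodal_weight :: "'a::field set \<Rightarrow> 'a \<Rightarrow> 'a"
  where "nodal_weight A b = inverse (\<Prod>c\<in>A - {b}. b - c)"

text \<open>Lagrange interpolation on \<open>A\<close> reproduces the monomial of degree
  \<open>m < card A\<close>; the claim compares coefficients at degree
  \<open>card A - 1\<close>.\<close>

lemma sum_nodal_weight_power:
  fixes A :: "'a::field set"
  assumes "finite A" "m < card A"
  shows "(\<Sum>b\<in>A. nodal_weight A b * b ^ m) = (if Suc m = card A then 1 else 0)"
proof -
  \<comment> \<open>Unnormalised Lagrange basis: for \<open>b\<close> in \<open>A\<close>,
    \<open>l b\<close> is monic of degree \<open>card A - 1\<close> and vanishes on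
    \<open>A - {b}\<close>; \<open>nodal_weight A b\<close> is the inverse of its value at
    \<open>b\<close>.\<close>
  define l where "l b = (\<Prod>c\<in>A - {b}. [:- c, 1:])" for b :: 'a
  define p where "p = (\<Sum>b\<in>A. smult (nodal_weight A b * b ^ m) (l b))"
  have deg_l: "degree (l b) = card A - 1" if "b \<in> A" for b
    unfolding l_def using that assms(1) by (subst degree_prod_eq_sum_degree) auto
  have coeff_l: "coeff (l b) (card A - 1) = 1" if "b \<in> A" for b
    using lead_coeff_prod[of "\<lambda>c. [:- c, 1:]" "A - {b}"] deg_l[OF that] by (simp add: l_def)
  have "degree p \<le> card A - 1"
    unfolding p_def by (intro degree_sum_le assms(1)) (use deg_l in \<open>auto intro: order_trans[OF degree_smult_le]\<close>)
  moreover have "poly p z = poly (monom 1 m) z" if "z \<in> A" for z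
  proof -
    have "poly p z = (\<Sum>b\<in>A. nodal_weight A b * b ^ m * poly (l b) z)"
      by (simp add: p_def poly_sum)
    also have "\<dots> = (\<Sum>b\<in>A. if b = z then z ^ m else 0)"
    proof (rule sum.cong)
      fix b assume "b \<in> A"
      show "nodal_weight A b * b ^ m * poly (l b) z = (if b = z then z ^ m else 0)"
      proof (cases "b = z")
        case True
        then show ?thesis using assms(1) by (simp add: l_def nodal_weight_def poly_prod)
      next
        case False
        then have "poly (l b) z = 0"
          using assms(1) \<open>z \<in> A\<close> by (auto simp: l_def poly_prod)
        then show ?thesis using False by simp
      qed
    qed simp
    also have "\<dots> = z ^ m" using assms(1) that by simp
    finally show ?thesis by (simp add: poly_monom)
  qed
  moreover have "degree (monom (1::'a) m) < card A"
    using assms(2) by (simp add: degree_monom_eq)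
  ultimately have "p = monom 1 m"
    using assms by (intro poly_eqI_degree[of A]) auto
  then have "coeff p (card A - 1) = coeff (monom 1 m) (card A - 1)" by simp
  moreover have "coeff p (card A - 1) = (\<Sum>b\<in>A. nodal_weight A b * b ^ m)"
    by (simp add: p_def coeff_sum coeff_l[unfolded One_nat_def])
  ultimately show ?thesis using assms(2) by (auto split: if_splits)
qed

definition grid_sum :: "'i set \<Rightarrow> ('i \<Rightarrow> 'a::field set) \<Rightarrow> (('i \<Rightarrow> 'a) \<Rightarrow> 'a) \<Rightarrow> 'a"
  where "grid_sum I A \<phi> = (\<Sum>x\<in>PiE I A. (\<Prod>i\<in>I. nodal_weight (A i) (x i)) * \<phi> x)"

lemma grid_sum_add: "grid_sum I A (\<lambda>x. \<phi> x + \<psi> x) = grid_sum I A \<phi> + grid_sum I A \<psi>"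
  by (simp add: grid_sum_def distrib_left sum.distrib)

lemma grid_sum_cmult: "grid_sum I A (\<lambda>x. c * \<phi> x) = c * grid_sum I A \<phi>"
  by (simp add: grid_sum_def sum_distrib_left mult_ac)

lemma grid_sum_sum: "grid_sum I A (\<lambda>x. \<Sum>s\<in>S. \<phi> s x) = (\<Sum>s\<in>S. grid_sum I A (\<phi> s))"
  unfolding grid_sum_def by (simp add: sum_distrib_left) (rule sum.swap)

lemma grid_sum_monomial:
  assumes "finite I" "\<And>i. i \<in> I \<Longrightarrow> finite (A i)"
  shows "grid_sum I A (\<lambda>x. \<Prod>i\<in>I. x i ^ e i) = (\<Prod>i\<in>I. \<Sum>b\<in>A i. nodal_weight (A i) b * b ^ e i)"
  using assms by (subst prod_sum_PiE) (auto simp: grid_sum_def prod.distrib)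

text \<open>The grid sum of a monomial factors into one-variable sums, so a single exponent below
  \<open>card (A j) - 1\<close> kills it, however large the others are.\<close>

lemma grid_sum_monomial_eq_0:
  assumes "finite I" "\<And>i. i \<in> I \<Longrightarrow> finite (A i)" "j \<in> I" "Suc (e j) < card (A j)"
  shows "grid_sum I A (\<lambda>x. \<Prod>i\<in>I. x i ^ e i) = 0"
proof -
  have "(\<Sum>b\<in>A j. nodal_weight (A j) b * b ^ e j) = 0"
    using assms by (subst sum_nodal_weight_power) auto
  then show ?thesis
    using assms(1,3) by (subst grid_sum_monomial[OF assms(1,2)]) auto
qed

lemma grid_sum_monomial_eq_1:
  assumes "finite I" "\<And>i. i \<in> I \<Longrightarrow> finite (A i)" "\<And>i. i \<in> I \<Longrightarrow> Suc (e i) = card (A i)"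
  shows "grid_sum I A (\<lambda>x. \<Prod>i\<in>I. x i ^ e i) = 1"
proof -
  have "(\<Sum>b\<in>A i. nodal_weight (A i) b * b ^ e i) = 1" if "i \<in> I" for i
    using assms(2,3)[OF that] by (subst sum_nodal_weight_power) auto
  then show ?thesis
    by (subst grid_sum_monomial[OF assms(1,2)]) auto
qed

section \<open>Polynomial functions of bounded degree\<close>

text \<open>The degree is strictly below \<open>D\<close>, so \<open>Suc D\<close> stands for degree at most \<open>D\<close>.\<close>

inductive_set low_degree :: "'i set \<Rightarrow> nat \<Rightarrow> (('i \<Rightarrow> 'a::comm_ring_1) \<Rightarrow> 'a) set"
  for I D where
  zero: "(\<lambda>_. 0) \<in> low_degree I D"
| monom: "\<phi> \<in> low_degree I D \<Longrightarrow> (\<Sum>i\<in>I. e i) < D \<Longrightarrow>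
    (\<lambda>x. c * (\<Prod>i\<in>I. x i ^ e i) + \<phi> x) \<in> low_degree I D"

lemma low_degree_monomial:
  assumes "(\<Sum>i\<in>I. e i) < D"
  shows "(\<lambda>x. c * (\<Prod>i\<in>I. x i ^ e i)) \<in> low_degree I D"
  using low_degree.monom[OF low_degree.zero assms] by simp

lemma low_degree_const: "0 < D \<Longrightarrow> (\<lambda>_. c) \<in> low_degree I D"
  using low_degree_monomial[of "\<lambda>_. 0" I D c] by simp

lemma low_degree_add:
  assumes "\<phi> \<in> low_degree I D" "\<psi> \<in> low_degree I D"
  shows "(\<lambda>x. \<phi> x + \<psi> x) \<in> low_degree I D"
  using assms(1)
proof induction
  case zero
  then show ?case using assms(2) by simp
next
  case (monom \<phi> e c)
  then show ?case using low_degree.monom[of _ I D e c] by (simp add: add.assoc)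
qed

lemma low_degree_sum:
  assumes "\<And>s. s \<in> S \<Longrightarrow> \<phi> s \<in> low_degree I D"
  shows "(\<lambda>x. \<Sum>s\<in>S. \<phi> s x) \<in> low_degree I D"
  using assms
  by (induction S rule: infinite_finite_induct) (auto intro: low_degree.zero low_degree_add)

lemma low_degree_mono:
  assumes "\<phi> \<in> low_degree I D" "D \<le> E"
  shows "\<phi> \<in> low_degree I E"
  using assms by induction (auto intro: low_degree.intros)

text \<open>One factor has degree at most \<open>D\<close>, the other degree strictly below
  \<open>E\<close>: an error term of lower order stays of lower order after multiplication.\<close>

lemma low_degree_mult:
  assumes "\<phi> \<in> low_degree I (Suc D)" "\<psi> \<in> low_degree I E"
  shows "(\<lambda>x. \<phi> x * \<psi> x) \<in> low_degree I (D + E)"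
  using assms(1)
proof induction
  case zero
  then show ?case by (simp add: low_degree.zero)
next
  case (monom \<phi> d b)
  have "(\<lambda>x. b * (\<Prod>i\<in>I. x i ^ d i) * \<psi> x) \<in> low_degree I (D + E)"
    using assms(2)
  proof induction
    case zero
    then show ?case by (simp add: low_degree.zero)
  next
    case (monom \<psi> e c)
    have "(\<lambda>x. (b * c) * (\<Prod>i\<in>I. x i ^ (d i + e i)) + b * (\<Prod>i\<in>I. x i ^ d i) * \<psi> x)
        \<in> low_degree I (D + E)"
      by (rule low_degree.monom[OF monom.IH])
        (use monom.hyps \<open>(\<Sum>i\<in>I. d i) < Suc D\<close> in \<open>simp add: sum.distrib\<close>)
    then show ?case by (simp add: algebra_simps power_add prod.distrib)
  qed
  from low_degree_add[OF this monom.IH] show ?case by (simp add: distrib_right)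
qed

text \<open>By pigeonhole every monomial of such a function has some exponent below
  \<open>card (A j) - 1\<close>.\<close>

lemma grid_sum_low_degree:
  assumes "finite I" "\<And>i. i \<in> I \<Longrightarrow> finite (A i)"
    and "\<phi> \<in> low_degree I (\<Sum>i\<in>I. card (A i) - 1)"
  shows "grid_sum I A \<phi> = 0"
  using assms(3)
proof induction
  case zero
  then show ?case by (simp add: grid_sum_def)
next
  case (monom \<phi> e c)
  obtain j where "j \<in> I" "e j < card (A j) - 1"
    using sum_mono[of I "\<lambda>i. card (A i) - 1" e] monom.hyps by (meson not_le)
  then have "grid_sum I A (\<lambda>x. \<Prod>i\<in>I. x i ^ e i) = 0"
    using assms(1,2) by (intro grid_sum_monomial_eq_0[of _ _ j]) auto
  then show ?case using monom.IH by (simp add: grid_sum_add grid_sum_cmult)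
qed

text \<open>Constants and lower terms of \<open>f\<close> do not affect the leading form of the
  product, which is a power of the leading form \<open>h\<close>.\<close>

lemma low_degree_prod_list_diff:
  fixes f h :: "('i \<Rightarrow> 'a::comm_ring_1) \<Rightarrow> 'a"
  assumes "h \<in> low_degree I (Suc k)" "(\<lambda>x. f x - h x) \<in> low_degree I k" "0 < k"
  shows "(\<lambda>x. (\<Prod>c\<leftarrow>cs. f x - c) - h x ^ length cs) \<in> low_degree I (k * length cs)"
proof -
  have hN: "(\<lambda>x. h x ^ N) \<in> low_degree I (Suc (k * N))" for N
  proof (induction N)
    case 0
    then show ?case by (simp add: low_degree_const)
  next
    case (Suc N)
    then show ?case using low_degree_mult[OF assms(1) Suc.IH] by simp
  qed
  show ?thesis
  proof (induction cs)
    case Nil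
    then show ?case by (simp add: low_degree.zero)
  next
    case (Cons c cs)
    let ?P = "\<lambda>x. \<Prod>c\<leftarrow>cs. f x - c"
    have d: "(\<lambda>x. f x - c - h x) \<in> low_degree I k"
      using low_degree_add[OF assms(2) low_degree_const[of k "- c"]] assms(3)
      by (simp add: algebra_simps)
    have "(\<lambda>x. f x - c) \<in> low_degree I (Suc k)"
      using low_degree_add[OF low_degree_mono[OF d] assms(1)] by simp
    from low_degree_mult[OF this Cons.IH]
    have "(\<lambda>x. (f x - c) * (?P x - h x ^ length cs)) \<in> low_degree I (k * length (c # cs))"
      by simp
    moreover have "(\<lambda>x. h x ^ length cs * (f x - c - h x)) \<in> low_degree I (k * length (c # cs))"
      using low_degree_mult[OF hN d] by (simp add: add.commute)
    \<comment> \<open>This sum telescopes to the difference for \<open>c # cs\<close>; each summand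
      has one factor of lowered degree.\<close>
    ultimately have "(\<lambda>x. (f x - c) * (?P x - h x ^ length cs) + h x ^ length cs * (f x - c - h x))
        \<in> low_degree I (k * length (c # cs))"
      by (rule low_degree_add)
    then show ?case by (simp add: algebra_simps)
  qed
qed

section \<open>The Vandermonde determinant\<close>

text \<open>The determinant of the matrix with entries \<open>x i ^ (j - 1)\<close>, in Leibniz form
  to exhibit its monomials. Permuted indices are at least \<open>1\<close>, so the subtraction never
  truncates.\<close>

definition vandermonde :: "nat \<Rightarrow> (nat \<Rightarrow> 'a::comm_ring_1) \<Rightarrow> 'a"
  where "vandermonde n x =
    (\<Sum>\<sigma> | \<sigma> permutes {1..n}. of_int (sign \<sigma>) * (\<Prod>i\<in>{1..n}. x i ^ (\<sigma> i - 1)))"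

text \<open>Composing with the transposition of \<open>i\<close> and \<open>j\<close> matches even
  with odd permutations and keeps the monomial's value. Cancelling in pairs also covers
  characteristic \<open>2\<close>, where a sign change alone would prove nothing.\<close>

lemma vandermonde_eq_0:
  fixes x :: "nat \<Rightarrow> 'a::comm_ring_1"
  assumes "i \<in> {1..n}" "j \<in> {1..n}" "i \<noteq> j" "x i = x j"
  shows "vandermonde n x = 0"
proof -
  let ?I = "{1..n}"
  let ?t = "transpose i j"
  define T where "T \<sigma> = (\<Prod>i\<in>?I. x i ^ (\<sigma> i - 1))" for \<sigma> :: "nat \<Rightarrow> nat"
  define E where "E = {\<sigma>. \<sigma> permutes ?I \<and> evenperm \<sigma>}"
  define U where "U = {\<sigma>. \<sigma> permutes ?I \<and> \<not> evenperm \<sigma>}"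
  have t: "?t permutes ?I" using assms by (simp add: permutes_swap_id)
  have perm: "permutation \<sigma>" if "\<sigma> permutes ?I" for \<sigma>
    using that by (meson finite_atLeastAtMost permutation_permutes)
  have par: "evenperm (\<sigma> \<circ> ?t) \<longleftrightarrow> \<not> evenperm \<sigma>" if "\<sigma> permutes ?I" for \<sigma>
    using evenperm_comp[OF perm[OF that] perm[OF t]] assms(3) by (simp add: evenperm_swap)
  have fin: "finite {\<sigma>. \<sigma> permutes ?I}" by (simp add: finite_permutations)
  have x_t: "x (?t l) = x l" for l
    using assms(4) by (simp add: transpose_def)
  have T_t: "T (\<sigma> \<circ> ?t) = T \<sigma>" for \<sigma>
  proof -
    have "T (\<sigma> \<circ> ?t) = (\<Prod>l\<in>?I. x (?t l) ^ (\<sigma> (?t l) - 1))"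
      unfolding T_def by (simp add: x_t)
    also have "\<dots> = T \<sigma>"
      unfolding T_def using prod.permute[OF t, of "\<lambda>l. x l ^ (\<sigma> l - 1)"] by (simp add: o_def)
    finally show ?thesis .
  qed
  have "sum T E = sum T U"
    by (rule sum.reindex_bij_witness[of _ "\<lambda>\<sigma>. \<sigma> \<circ> ?t" "\<lambda>\<sigma>. \<sigma> \<circ> ?t"])
      (auto simp: E_def U_def par T_t comp_assoc permutes_compose[OF t] simp del: One_nat_def)
  moreover have "vandermonde n x = sum T E - sum T U"
  proof -
    have "vandermonde n x = (\<Sum>\<sigma>\<in>E \<union> U. of_int (sign \<sigma>) * T \<sigma>)"
      unfolding vandermonde_def T_def by (rule sum.cong) (auto simp: E_def U_def)
    also have "\<dots> = (\<Sum>\<sigma>\<in>E. of_int (sign \<sigma>) * T \<sigma>) + (\<Sum>\<sigma>\<in>U. of_int (sign \<sigma>) * T \<sigma>)"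
      by (rule sum.union_disjoint) (auto simp: E_def U_def intro: finite_subset[OF _ fin])
    also have "(\<Sum>\<sigma>\<in>E. of_int (sign \<sigma>) * T \<sigma>) = sum T E"
      by (rule sum.cong) (auto simp: E_def sign_def)
    also have "(\<Sum>\<sigma>\<in>U. of_int (sign \<sigma>) * T \<sigma>) = - sum T U"
      unfolding sum_negf[symmetric] by (rule sum.cong) (auto simp: U_def sign_def)
    finally show ?thesis by simp
  qed
  ultimately show ?thesis by simp
qed

lemma sum_permutes_diff_1:
  assumes "\<sigma> permutes {1..n}"
  shows "(\<Sum>i\<in>{1..n}. \<sigma> i - 1) = (\<Sum>i\<in>{1..n}. i - 1)"
  using sum.permute[OF assms, of "\<lambda>i. i - 1"] by (simp add: o_def)

lemma low_degree_vandermonde: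
  "vandermonde n \<in> low_degree {1..n} (Suc (\<Sum>i\<in>{1..n}. i - 1))"
  unfolding vandermonde_def[abs_def]
  by (intro low_degree_sum low_degree_monomial) (simp add: sum_permutes_diff_1 del: One_nat_def)

section \<open>Multinomial coefficients\<close>

text \<open>The multinomial theorem indexed by words, so that a multinomial coefficient appears as
  the number of arrangements of a multiset.\<close>

lemma sum_power_eq_sum_lists:
  fixes y :: "'i \<Rightarrow> 'a::comm_semiring_1"
  assumes "finite I"
  shows "(\<Sum>i\<in>I. y i) ^ N =
    (\<Sum>xs | set xs \<subseteq> I \<and> length xs = N. \<Prod>i\<in>I. y i ^ count (mset xs) i)"
proof (induction N)
  case 0
  have "{xs. set xs \<subseteq> I \<and> length xs = 0} = {[]}" by auto
  then show ?case by simp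
next
  case (Suc N)
  let ?L = "\<lambda>N. {xs. set xs \<subseteq> I \<and> length xs = N}"
  let ?T = "\<lambda>xs. \<Prod>i\<in>I. y i ^ count (mset xs) i"
  have T_Cons: "?T (j # xs) = y j * ?T xs" if "j \<in> I" for j xs
  proof -
    have "?T (j # xs) = (\<Prod>i\<in>I. (if i = j then y i else 1) * y i ^ count (mset xs) i)"
      by (rule prod.cong) auto
    also have "\<dots> = y j * ?T xs"
      using assms that by (simp add: prod.distrib)
    finally show ?thesis .
  qed
  have L_Suc: "?L (Suc N) = (\<lambda>(j, xs). j # xs) ` (I \<times> ?L N)"
    by (auto simp: length_Suc_conv image_iff)
  have "(\<Sum>i\<in>I. y i) ^ Suc N = (\<Sum>i\<in>I. y i) * (\<Sum>xs\<in>?L N. ?T xs)"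
    by (simp add: Suc.IH)
  also have "\<dots> = (\<Sum>j\<in>I. \<Sum>xs\<in>?L N. ?T (j # xs))"
    by (simp only: sum_product) (intro sum.cong refl, simp only: T_Cons)
  also have "\<dots> = (\<Sum>(j, xs)\<in>I \<times> ?L N. ?T (j # xs))"
    by (rule sum.cartesian_product)
  also have "\<dots> = sum ?T (?L (Suc N))"
    unfolding L_Suc by (subst sum.reindex) (auto simp: inj_on_def o_def case_prod_unfold)
  finally show ?case .
qed

text \<open>The number of arrangements divides \<open>fact (size M)\<close>, which is nonzero in the
  field because \<open>size M\<close> is below any positive characteristic.\<close>

lemma of_nat_card_permutations_of_multiset_neq_0:
  assumes "CHAR('a::field) = 0 \<or> size M < CHAR('a)"
  shows "of_nat (card (permutations_of_multiset M)) \<noteq> (0::'a)"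
proof -
  have "of_nat (fact (size M)) \<noteq> (0::'a)"
  proof (cases "CHAR('a) = 0")
    case True
    then show ?thesis by (simp add: of_nat_eq_0_iff_char_dvd del: of_nat_fact)
  next
    case False
    then have "prime CHAR('a)" by (simp add: prime_CHAR_semidom)
    then show ?thesis
      using assms False by (simp add: of_nat_eq_0_iff_char_dvd prime_dvd_fact_iff del: of_nat_fact)
  qed
  then show ?thesis
    by (subst (asm) card_permutations_of_multiset_aux[symmetric]) auto
qed

section \<open>The value set\<close>

text \<open>A summand of the multinomial expansion times the Vandermonde determinant has exponents
  \<open>k * t i + (\<sigma> i - 1)\<close>. Since \<open>n \<le> k\<close>, reduction modulo \<open>k\<close> shows that these can equal
  \<open>k * q i + (i - 1)\<close> only for \<open>\<sigma> = id\<close>.\<close>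

lemma grid_sum_diagonal_power_vandermonde:
  fixes a :: "nat \<Rightarrow> 'a::field"
  assumes "n \<le> k"
    and fin: "\<And>i. i \<in> {1..n} \<Longrightarrow> finite (B i)"
    and card: "\<And>i. i \<in> {1..n} \<Longrightarrow> card (B i) = k * count M i + i"
    and M: "set_mset M \<subseteq> {1..n}"
  shows "grid_sum {1..n} B (\<lambda>x. (\<Sum>i\<in>{1..n}. a i * x i ^ k) ^ size M * vandermonde n x) =
    of_nat (card (permutations_of_multiset M)) * (\<Prod>i\<in>{1..n}. a i ^ count M i)"
proof -
  let ?I = "{1..n}"
  let ?S = "{\<sigma>. \<sigma> permutes ?I}"
  let ?L = "{xs. set xs \<subseteq> ?I \<and> length xs = size M}"
  let ?e = "\<lambda>xs \<sigma> i. k * count (mset xs) i + (\<sigma> i - 1)"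
  let ?G = "\<lambda>xs \<sigma>. grid_sum ?I B (\<lambda>x. \<Prod>i\<in>?I. x i ^ ?e xs \<sigma> i)"
  have finL: "finite ?L" by (simp add: finite_lists_length_eq)
  have finS: "finite ?S" by (simp add: finite_permutations)
  have G: "?G xs \<sigma> = (if mset xs = M \<and> \<sigma> = id then 1 else 0)" if xs: "xs \<in> ?L" and \<sigma>: "\<sigma> \<in> ?S" for xs \<sigma>
  proof (cases "\<exists>j\<in>?I. Suc (?e xs \<sigma> j) < card (B j)")
    case True
    then obtain j where j: "j \<in> ?I" "Suc (?e xs \<sigma> j) < card (B j)" by blast
    have "?G xs \<sigma> = 0" by (rule grid_sum_monomial_eq_0[of _ _ j]) (use fin j in auto)
    moreover have "\<not> (mset xs = M \<and> \<sigma> = id)" using j card by auto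
    ultimately show ?thesis by simp
  next
    case False
    have size_eq: "(\<Sum>i\<in>?I. count N i) = size N" if "set_mset N \<subseteq> ?I" for N
      unfolding size_multiset_overloaded_eq using that
      by (intro sum.mono_neutral_right) (auto simp: count_eq_zero_iff)
    \<comment> \<open>No exponent falls short of its target, and the totals agree, so all exponents
      are equal to their targets.\<close>
    have "(\<Sum>i\<in>?I. k * count M i + (i - 1)) = (\<Sum>i\<in>?I. ?e xs \<sigma> i)"
      unfolding sum.distrib sum_distrib_left[symmetric]
      using sum_permutes_diff_1[of \<sigma> n] \<sigma> xs size_eq[OF M] size_eq[of "mset xs"]
      by (simp del: One_nat_def)
    moreover have "k * count M i + (i - 1) \<le> ?e xs \<sigma> i" if "i \<in> ?I" for i
    proof -
      have "\<not> Suc (?e xs \<sigma> i) < card (B i)" using False that by blast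
      then show ?thesis using card[OF that] that by simp
    qed
    ultimately have eq: "k * count M i + (i - 1) = ?e xs \<sigma> i" if "i \<in> ?I" for i
      by (rule sum_mono_inv) (use that in auto)
    have *: "\<sigma> i = i \<and> count (mset xs) i = count M i" if i: "i \<in> ?I" for i
    proof -
      have "\<sigma> i \<in> ?I" using \<sigma> i permutes_in_image by fastforce
      then have lt: "i - 1 < k" "\<sigma> i - 1 < k" using i assms(1) by auto
      have "(k * count M i + (i - 1)) mod k = ?e xs \<sigma> i mod k"
        "(k * count M i + (i - 1)) div k = ?e xs \<sigma> i div k"
        using eq[OF i] by simp_all
      then show ?thesis using lt \<open>\<sigma> i \<in> ?I\<close> i by auto
    qed
    then have "\<sigma> = id" using \<sigma> by (auto simp: fun_eq_iff permutes_def)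
    moreover have "mset xs = M"
    proof (rule multiset_eqI)
      fix i
      show "count (mset xs) i = count M i"
      proof (cases "i \<in> ?I")
        case True
        then show ?thesis using * by blast
      next
        case False
        then have "i \<notin># mset xs" "i \<notin># M" using xs M by auto
        then show ?thesis by (simp add: not_in_iff)
      qed
    qed
    moreover have "?G xs \<sigma> = 1"
      by (rule grid_sum_monomial_eq_1) (use fin card \<open>\<sigma> = id\<close> \<open>mset xs = M\<close> in auto)
    ultimately show ?thesis by simp
  qed
  have "grid_sum ?I B (\<lambda>x. (\<Sum>i\<in>?I. a i * x i ^ k) ^ size M * vandermonde n x) =
    grid_sum ?I B (\<lambda>x. \<Sum>xs\<in>?L. \<Sum>\<sigma>\<in>?S.
      ((\<Prod>i\<in>?I. a i ^ count (mset xs) i) * of_int (sign \<sigma>)) * (\<Prod>i\<in>?I. x i ^ ?e xs \<sigma> i))"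
    unfolding sum_power_eq_sum_lists[OF finite_atLeastAtMost] vandermonde_def sum_product
    by (simp add: power_mult_distrib prod.distrib power_add power_mult mult_ac)
  also have "\<dots> = (\<Sum>xs\<in>?L. \<Sum>\<sigma>\<in>?S.
      ((\<Prod>i\<in>?I. a i ^ count (mset xs) i) * of_int (sign \<sigma>)) * ?G xs \<sigma>)"
    by (simp only: grid_sum_sum grid_sum_cmult)
  also have "\<dots> = (\<Sum>xs\<in>?L. \<Sum>\<sigma>\<in>?S.
      if \<sigma> = id then (if mset xs = M then (\<Prod>i\<in>?I. a i ^ count M i) else 0) else 0)"
    by (intro sum.cong refl, subst G) auto
  also have "\<dots> = (\<Sum>xs\<in>?L. if mset xs = M then (\<Prod>i\<in>?I. a i ^ count M i) else 0)"
    using finS by (simp add: permutes_id)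
  \<comment> \<open>The surviving words are the arrangements of \<open>M\<close>, all with the same
    term.\<close>
  also have "\<dots> = (\<Sum>xs\<in>permutations_of_multiset M. \<Prod>i\<in>?I. a i ^ count M i)"
  proof -
    have "permutations_of_multiset M = {xs \<in> ?L. mset xs = M}"
      using M by (auto simp: permutations_of_multiset_def)
    then show ?thesis
      using sum.inter_filter[OF finL, of "\<lambda>_. \<Prod>i\<in>?I. a i ^ count M i" "\<lambda>xs. mset xs = M"]
      by (simp only: mem_Collect_eq)
  qed
  finally show ?thesis by simp
qed

text \<open>Used with \<open>C\<close> the set of all restricted values, where it is a
  contradiction. The exact sizes of the \<open>B i\<close> make the grid fit the top degree.\<close>

lemma ex_injective_grid_point:
  fixes f :: "(nat \<Rightarrow> 'a::field) \<Rightarrow> 'a"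
  assumes "0 < k" "n \<le> k"
    and a: "\<And>i. i \<in> {1..n} \<Longrightarrow> a i \<noteq> 0"
    and f: "(\<lambda>x. f x - (\<Sum>i\<in>{1..n}. a i * x i ^ k)) \<in> low_degree {1..n} k"
    and fin: "\<And>i. i \<in> {1..n} \<Longrightarrow> finite (B i)"
    and card: "\<And>i. i \<in> {1..n} \<Longrightarrow> card (B i) = k * q i + i"
    and char: "CHAR('a) = 0 \<or> (\<Sum>i\<in>{1..n}. q i) < CHAR('a)"
    and C: "finite C" "card C \<le> (\<Sum>i\<in>{1..n}. q i)"
  shows "\<exists>x\<in>PiE {1..n} B. inj_on x {1..n} \<and> f x \<notin> C"
proof (rule ccontr)
  assume contra: "\<not> ?thesis"
  let ?I = "{1..n}"
  define h where "h x = (\<Sum>i\<in>?I. a i * x i ^ k)" for x :: "nat \<Rightarrow> 'a"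
  define M where "M = (\<Sum>i\<in>?I. replicate_mset (q i) i)"
  have count_M: "count M i = (if i \<in> ?I then q i else 0)" for i
    by (simp add: M_def count_sum)
  have size_M: "size M = (\<Sum>i\<in>?I. q i)" by (simp add: M_def)
  have set_M: "set_mset M \<subseteq> ?I"
    using count_M by (metis count_eq_zero_iff subsetI)
  obtain cs0 where cs0: "set cs0 = C" "distinct cs0" using C(1) finite_distinct_list by blast
  \<comment> \<open>Padding gives exactly \<open>size M\<close> factors; extra factors keep the
    product zero wherever \<open>f\<close> takes a value in \<open>C\<close>.\<close>
  define cs where "cs = cs0 @ replicate (size M - length cs0) 0"
  have cs: "C \<subseteq> set cs" "length cs = size M"
    using cs0 C(2) by (auto simp: cs_def size_M distinct_card)
  let ?P = "\<lambda>x. \<Prod>c\<leftarrow>cs. f x - c"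
  have "grid_sum ?I B (\<lambda>x. ?P x * vandermonde n x) = 0"
    unfolding grid_sum_def
  proof (intro sum.neutral ballI)
    fix x assume x: "x \<in> PiE ?I B"
    have "?P x * vandermonde n x = 0"
    proof (cases "inj_on x ?I")
      case True
      then have "f x \<in> set cs" using contra x cs(1) by blast
      then show ?thesis by (auto simp: prod_list_zero_iff)
    next
      case False
      then have "vandermonde n x = 0" by (meson inj_onI vandermonde_eq_0)
      then show ?thesis by simp
    qed
    then show "(\<Prod>i\<in>?I. nodal_weight (B i) (x i)) * (?P x * vandermonde n x) = 0" by simp
  qed
  \<comment> \<open>Replacing the product by \<open>h x ^ size M\<close> changes only terms that the
    grid sum annihilates.\<close>
  moreover have "grid_sum ?I B (\<lambda>x. (?P x - h x ^ size M) * vandermonde n x) = 0"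
  proof (rule grid_sum_low_degree)
    have "(\<lambda>x. a j * x j ^ k) \<in> low_degree ?I (Suc k)" if "j \<in> ?I" for j
    proof -
      have "(\<lambda>x. a j * (\<Prod>i\<in>?I. x i ^ (if i = j then k else 0))) \<in> low_degree ?I (Suc k)"
        by (rule low_degree_monomial) simp
      moreover have "(\<Prod>i\<in>?I. x i ^ (if i = j then k else 0)) = x j ^ k" for x :: "nat \<Rightarrow> 'a"
        using that by (simp add: if_distrib[of "\<lambda>m. _ ^ m"] prod.delta cong: if_cong)
      ultimately show ?thesis by simp
    qed
    then have "h \<in> low_degree ?I (Suc k)"
      unfolding h_def[abs_def] by (rule low_degree_sum)
    from low_degree_prod_list_diff[OF this f[folded h_def] assms(1), of cs]
    have *: "(\<lambda>x. ?P x - h x ^ size M) \<in> low_degree ?I (k * size M)" by (simp add: cs(2))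
    show "(\<lambda>x. (?P x - h x ^ size M) * vandermonde n x) \<in> low_degree ?I (\<Sum>i\<in>?I. card (B i) - 1)"
    proof -
      \<comment> \<open>The grid detects total degree \<open>k * size M\<close> plus the Vandermonde
        degree; the error term lies strictly below.\<close>
      have "card (B i) - 1 = (i - 1) + k * q i" if "i \<in> ?I" for i
        using card[OF that] that by simp
      then have "(\<Sum>i\<in>?I. card (B i) - 1) = (\<Sum>i\<in>?I. (i - 1) + k * q i)"
        by (rule sum.cong[OF refl])
      then have "(\<Sum>i\<in>?I. card (B i) - 1) = (\<Sum>i\<in>?I. i - 1) + k * size M"
        by (simp only: size_M sum_distrib_left sum.distrib)
      then show ?thesis
        using low_degree_mult[OF low_degree_vandermonde *] by (simp only: mult.commute)
    qed
  qed (use fin in auto)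
  ultimately have "grid_sum ?I B (\<lambda>x. h x ^ size M * vandermonde n x) = 0"
    using grid_sum_add[of ?I B "\<lambda>x. (?P x - h x ^ size M) * vandermonde n x"
        "\<lambda>x. h x ^ size M * vandermonde n x"]
    by (simp add: algebra_simps)
  moreover have "grid_sum ?I B (\<lambda>x. h x ^ size M * vandermonde n x) =
      of_nat (card (permutations_of_multiset M)) * (\<Prod>i\<in>?I. a i ^ count M i)"
    unfolding h_def
    by (rule grid_sum_diagonal_power_vandermonde) (use assms set_M count_M in auto)
  ultimately show False
    using of_nat_card_permutations_of_multiset_neq_0[of M, where ?'a = 'a] char a
    by (auto simp: size_M)
qed

section \<open>Evaluation of polynomials\<close>

text \<open>Cancellation can shrink the keys of a sum, so additivity of \<open>meval\<close> is
  proved over a common index set.\<close>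

lemma meval_superset:
  assumes "finite S" "Poly_Mapping.keys p \<subseteq> S"
  shows "meval p x = (\<Sum>m\<in>S. Poly_Mapping.lookup p m *
    (\<Prod>i\<in>Poly_Mapping.keys m. x i ^ Poly_Mapping.lookup m i))"
  unfolding meval_def using assms
  by (intro sum.mono_neutral_left) (auto simp: in_keys_iff)

lemma meval_add: "meval (p + q) x = meval p x + meval q x"
proof -
  let ?S = "Poly_Mapping.keys p \<union> Poly_Mapping.keys q"
  show ?thesis
    using meval_superset[of ?S p x] meval_superset[of ?S q x]
      meval_superset[of ?S "p + q" x] Poly_Mapping.keys_add[of p q]
    by (simp add: lookup_add distrib_right sum.distrib)
qed

lemma meval_0 [simp]: "meval 0 x = 0"
  by (simp add: meval_def)

lemma meval_sum: "meval (\<Sum>s\<in>S. p s) x = (\<Sum>s\<in>S. meval (p s) x)"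
  by (induction S rule: infinite_finite_induct) (auto simp: meval_add)

lemma mvar_power: "mvar i ^ k = Poly_Mapping.single (Poly_Mapping.single i k) (1::'a::comm_semiring_1)"
  by (induction k) (auto simp: mvar_def mult_single single_add[symmetric] single_one)

lemma meval_mconst_mult_mvar_power: "meval (mconst c * mvar i ^ k) x = c * x i ^ k"
  by (cases "c = 0"; cases "k = 0") (auto simp: mvar_power mconst_def mult_single meval_def)

lemma prod_keys_eq:
  assumes "finite I" "Poly_Mapping.keys m \<subseteq> I"
  shows "(\<Prod>i\<in>Poly_Mapping.keys m. x i ^ Poly_Mapping.lookup m i) =
    (\<Prod>i\<in>I. x i ^ Poly_Mapping.lookup m i :: 'a::comm_semiring_1)"
  using assms by (intro prod.mono_neutral_left) (auto simp: in_keys_iff)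

lemma low_degree_meval:
  assumes "finite I" "mvars p \<subseteq> I" "total_degree p < k"
  shows "meval p \<in> low_degree I k"
proof -
  have "(\<lambda>x. Poly_Mapping.lookup p m * (\<Prod>i\<in>Poly_Mapping.keys m. x i ^ Poly_Mapping.lookup m i))
      \<in> low_degree I k" if m: "m \<in> Poly_Mapping.keys p" for m
  proof -
    have mI: "Poly_Mapping.keys m \<subseteq> I" using m assms(2) by (auto simp: mvars_def)
    have "(\<Sum>i\<in>I. Poly_Mapping.lookup m i) = exp_degree m"
      unfolding exp_degree_def using assms(1) mI
      by (intro sum.mono_neutral_right) (auto simp: in_keys_iff)
    also have "\<dots> \<le> total_degree p"
      unfolding total_degree_def using m by (intro Max_ge) auto
    finally show ?thesis
      using assms(3) unfolding prod_keys_eq[OF assms(1) mI] by (intro low_degree_monomial) auto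
  qed
  then show ?thesis unfolding meval_def[abs_def] by (rule low_degree_sum)
qed

lemma meval_cong:
  assumes "\<And>i. i \<in> mvars p \<Longrightarrow> x i = y i"
  shows "meval p x = meval p y"
proof -
  have "x i ^ Poly_Mapping.lookup m i = y i ^ Poly_Mapping.lookup m i"
    if "m \<in> Poly_Mapping.keys p" "i \<in> Poly_Mapping.keys m" for m i
  proof -
    have "i \<in> mvars p" unfolding mvars_def using that by blast
    then show ?thesis using assms by simp
  qed
  then show ?thesis unfolding meval_def by simp
qed

section \<open>Shrinking the sets and the final bound\<close>

lemma ex_sum_le_eq:
  fixes q :: "'i \<Rightarrow> nat"
  assumes "finite I" "N \<le> (\<Sum>i\<in>I. q i)"
  shows "\<exists>r. (\<forall>i\<in>I. r i \<le> q i) \<and> (\<Sum>i\<in>I. r i) = N"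
  using assms
proof (induction I arbitrary: N)
  case empty
  then show ?case by simp
next
  case (insert j I)
  \<comment> \<open>Greedy choice: index \<open>j\<close> takes \<open>min N (q j)\<close> and the
    rest is left to \<open>I\<close>.\<close>
  obtain r where r: "\<forall>i\<in>I. r i \<le> q i" "(\<Sum>i\<in>I. r i) = N - min N (q j)"
    using insert.IH[of "N - min N (q j)"] insert by fastforce
  have "(\<Sum>i\<in>I. (r(j := min N (q j))) i) = (\<Sum>i\<in>I. r i)"
    using insert.hyps(2) by (intro sum.cong) auto
  then have "(\<Sum>i\<in>insert j I. (r(j := min N (q j))) i) = N"
    using insert.hyps r(2) by simp
  then show ?case
    using r(1) by (intro exI[of _ "r(j := min N (q j))"]) auto
qed

theorem theorem1p2:
  fixes f g :: "'a::field mpoly"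
    and a :: "nat \<Rightarrow> 'a"
    and A :: "nat \<Rightarrow> 'a set"
    and n k :: nat
  assumes "n \<ge> 1" and "k \<ge> 1"
    and "\<forall>i\<in>{1..n}. a i \<noteq> 0"
    and "mvars g \<subseteq> {1..n}" and "total_degree g < k"
    and "f = (\<Sum>i=1..n. mconst (a i) * mvar i ^ k) + g"
    and "n \<le> k" and "k = total_degree f"
    and "\<forall>i\<in>{1..n}. finite (A i) \<and> card (A i) \<ge> i"
  shows "ereal (real (card (restricted_values f n A))) \<ge>
    min (add_order_one TYPE('a))
        (ereal (real_of_int ((\<Sum>i=1..n. \<lfloor>(real (card (A i)) - real i) / real k\<rfloor>) + 1)))"
proof -
  let ?I = "{1..n}"
  let ?V = "restricted_values f n A"
  define q where "q i = (card (A i) - i) div k" for i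
  \<comment> \<open>The claimed bound minus one. The cap at \<open>CHAR('a) - 1\<close> keeps the
    multinomial coefficient nonzero.\<close>
  define N where "N = (if CHAR('a) = 0 then \<Sum>i\<in>?I. q i else min (\<Sum>i\<in>?I. q i) (CHAR('a) - 1))"
  have meval_f: "meval f x = (\<Sum>i\<in>?I. a i * x i ^ k) + meval g x" for x
    by (simp add: assms(6) meval_add meval_sum meval_mconst_mult_mvar_power)
  have cong: "meval f x = meval f y" if "\<And>i. i \<in> ?I \<Longrightarrow> x i = y i" for x y
  proof -
    have "meval g x = meval g y" using that assms(4) by (intro meval_cong) auto
    then show ?thesis using that by (simp add: meval_f)
  qed
  \<comment> \<open>Points in \<open>restricted_values\<close> are functions on all of
    \<open>nat\<close>; restricting them to \<open>?I\<close> shows that there are finitely many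
    values.\<close>
  have "?V \<subseteq> meval f ` PiE ?I A"
  proof
    fix v assume "v \<in> ?V"
    then obtain x where x: "v = meval f x" "\<forall>i\<in>?I. x i \<in> A i"
      by (auto simp: restricted_values_def)
    have "v = meval f (restrict x ?I)" unfolding x(1) by (rule cong) auto
    then show "v \<in> meval f ` PiE ?I A" using x(2) by (intro image_eqI[of _ _ "restrict x ?I"]) auto
  qed
  moreover have "finite (PiE ?I A)" using assms(9) by (intro finite_PiE) auto
  ultimately have fin_V: "finite ?V" using finite_surj by blast
  have "N \<le> (\<Sum>i\<in>?I. q i)" by (simp add: N_def)
  then obtain r where r: "\<forall>i\<in>?I. r i \<le> q i" "(\<Sum>i\<in>?I. r i) = N"
    using ex_sum_le_eq[of ?I N q] by auto
  have "\<exists>B. B \<subseteq> A i \<and> card B = k * r i + i" if "i \<in> ?I" for i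
  proof -
    have "k * r i \<le> k * q i" using r(1) that by simp
    also have "\<dots> \<le> card (A i) - i" by (simp add: q_def)
    finally have "k * r i + i \<le> card (A i)" using assms(9) that by fastforce
    then show ?thesis using obtain_subset_with_card_n by metis
  qed
  then obtain B where B: "\<And>i. i \<in> ?I \<Longrightarrow> B i \<subseteq> A i \<and> card (B i) = k * r i + i"
    by metis
  have "N < card ?V"
  proof (rule ccontr)
    assume "\<not> N < card ?V"
    have "\<exists>x\<in>PiE ?I B. inj_on x ?I \<and> meval f x \<notin> ?V"
    proof (rule ex_injective_grid_point)
      show "(\<lambda>x. meval f x - (\<Sum>i\<in>?I. a i * x i ^ k)) \<in> low_degree ?I k"
        using low_degree_meval[OF _ assms(4,5)] by (simp add: meval_f)
      show "CHAR('a) = 0 \<or> (\<Sum>i\<in>?I. r i) < CHAR('a)"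
        unfolding r(2) by (auto simp: N_def)
      show "card ?V \<le> (\<Sum>i\<in>?I. r i)" using \<open>\<not> N < card ?V\<close> r(2) by simp
      show "finite (B i)" if "i \<in> ?I" for i
        using B[OF that] assms(9) that finite_subset by blast
    qed (use assms(2,3,7) B fin_V in simp_all)
    then obtain x where x: "x \<in> PiE ?I B" "inj_on x ?I" "meval f x \<notin> ?V" by blast
    have "\<forall>i\<in>?I. x i \<in> A i" using x(1) B by (blast dest: PiE_mem)
    moreover have "\<forall>i\<in>?I. \<forall>j\<in>?I. i \<noteq> j \<longrightarrow> x i \<noteq> x j" using x(2) by (blast dest: inj_onD)
    ultimately have "meval f x \<in> ?V" unfolding restricted_values_def by blast
    with x(3) show False by simp
  qed
  \<comment> \<open>Since \<open>i \<le> card (A i)\<close>, natural and real subtraction agree and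
    the floor is \<open>div\<close>.\<close>
  have "\<lfloor>(real (card (A i)) - real i) / real k\<rfloor> = int (q i)" if "i \<in> ?I" for i
    using assms(9) that floor_divide_of_nat_eq[of "card (A i) - i" k, where ?'a = real]
    by (simp add: q_def of_nat_diff)
  then have sum_floor: "(\<Sum>i=1..n. \<lfloor>(real (card (A i)) - real i) / real k\<rfloor>) = int (\<Sum>i\<in>?I. q i)"
    by simp
  \<comment> \<open>If the cap is active, \<open>N + 1\<close> is the characteristic; otherwise it
    is the sum of the floors plus one.\<close>
  have "CHAR('a) \<le> card ?V \<and> CHAR('a) \<noteq> 0 \<or> (\<Sum>i\<in>?I. q i) + 1 \<le> card ?V"
    using \<open>N < card ?V\<close> by (auto simp: N_def min_def split: if_splits)
  then have "real CHAR('a) \<le> real (card ?V) \<and> CHAR('a) \<noteq> 0 \<or>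
      real_of_int (int (\<Sum>i\<in>?I. q i) + 1) \<le> real (card ?V)"
    by linarith
  then show ?thesis
    unfolding sum_floor add_order_one_def by (auto simp: min_le_iff_disj simp del: of_nat_sum)
qed

end
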